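(* Let $(\mathcal{X},d_{\mathcal{X}})$ be a compact metric space, $(\mathcal{Y},d_{\mathcal{Y}})$ a metric space, $X_N=\{x_1,\ldots,x_N\}\subset\mathcal{X}$ a finite set of data sites, $Y_N=\{y_1,\ldots,y_N\}\subset\mathcal{Y}$, and $f_N\colon X_N\to Y_N$, $x_i\mapsto y_i$. Let $f_N$ be of class $\rho$, where $\rho\colon[0,\infty]\to[0,\infty]$ is monotonically increasing with $\rho\geq C\,\omega_N(f_N,\cdot)$ for some $C>0$. Let $X_N=\bigcup_{i=1}^M X^{(i)}$ be a partition into mutually disjoint sets, let $\hat{x}_i\in X^{(i)}$ for $i=1,\ldots,M$, and assume that there exists $h>0$ with $\operatorname{diam}(X^{(i)})\leq h$ for $i=1,\ldots,M$. Then $$\sup_{x\in X_N}d_{\mathcal{Y}}\big(f_N(x),(I_{\Xi_M}f_N)(x)\big)\leq\rho(h)\,|f_N|_{\rho,N}.$$ For the specific choice $\rho=\omega_N(f_N,\cdot)$ one obtains $$\sup_{x\in X_N}d_{\mathcal{Y}}\big(f_N(x),(I_{\Xi_M}f_N)(x)\big)\leq\omega_N(f_N,h).$$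
   Context: Put $d_{i,j}=d_{\mathcal{X}}(x_i,x_j)$. The discrete modulus of continuity is $\omega_N(f_N,t)=\max\{d_{\mathcal{Y}}(y_i,y_j): d_{i,j}\leq t\}$, and $|f_N|_{\rho,N}=\max_{i\neq j}\rho(d_{i,j})^{-1}\omega_N(f_N,d_{i,j})$; $f_N$ is of class $\rho$ if this quantity is finite. With $\Xi_M=\{(\hat{x}_i,X^{(i)})\}_{i=1}^M$, the interpolant is $I_{\Xi_M}f_N=\sum_{i=1}^M f_N(\hat{x}_i)\mathbf{1}_{X^{(i)}}$, that is, $(I_{\Xi_M}f_N)(x)=f_N(\hat{x}_i)$ for $x\in X^{(i)}$.
   Formalization: The first bound is asserted only when ρ(h)|f_N|_{ρ,N} is not the indeterminate product ∞·0, i.e. not both ρ(h)=∞ and |f_N|_{ρ,N}=0; for ρ≡∞ and non-constant f_N the bound would read "error ≤ ∞·0". *)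

theory Defs
  imports "HOL-Analysis.Analysis"
begin

text \<open>Data sites are \<open>x 1, ..., x N\<close> with values \<open>y 1, ..., y N\<close>.  Since the
  majorant \<open>\<rho>\<close> maps \<open>[0,\<infinity>]\<close> to itself, the modulus is defined on and valued in \<open>ennreal\<close>.\<close>

definition disc_modulus ::
  "nat \<Rightarrow> (nat \<Rightarrow> 'a::metric_space) \<Rightarrow> (nat \<Rightarrow> 'b::metric_space) \<Rightarrow> ennreal \<Rightarrow> ennreal" where
  "disc_modulus N x y t =
     Max {ennreal (dist (y i) (y j)) |i j.
            i \<in> {1..N} \<and> j \<in> {1..N} \<and> ennreal (dist (x i) (x j)) \<le> t}"

text \<open>The maximum over \<open>i \<noteq> j\<close> is written as a supremum, so that it is \<open>0\<close> when \<open>N = 1\<close>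
  and there are no such pairs.  The arithmetic of \<open>ennreal\<close> has \<open>inverse 0 = \<infinity>\<close>,
  \<open>inverse \<infinity> = 0\<close> and \<open>\<infinity> * 0 = 0\<close>; hence a pair on which both \<open>\<rho>\<close> and the modulus vanish
  contributes \<open>0\<close>.  This is needed for the choice of the modulus itself as \<open>\<rho>\<close>.
  Conversely, if \<open>\<rho> = \<infinity>\<close> then the seminorm is \<open>0\<close> for every \<open>y\<close>, and a bound
  \<open>\<rho> h * disc_seminorm \<rho> N x y\<close> would evaluate to \<open>\<infinity> * 0 = 0\<close>; such a bound is
  meaningful only when it is not of this indeterminate form.\<close>

definition disc_seminorm ::
  "(ennreal \<Rightarrow> ennreal) \<Rightarrow> nat \<Rightarrow> (nat \<Rightarrow> 'a::metric_space) \<Rightarrow> (nat \<Rightarrow> 'b::metric_space) \<Rightarrow> ennreal" where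
  "disc_seminorm \<rho> N x y =
     (SUP (i, j) \<in> {(i, j). i \<in> {1..N} \<and> j \<in> {1..N} \<and> i \<noteq> j}.
        inverse (\<rho> (ennreal (dist (x i) (x j))))
          * disc_modulus N x y (ennreal (dist (x i) (x j))))"

definition of_class ::
  "(ennreal \<Rightarrow> ennreal) \<Rightarrow> nat \<Rightarrow> (nat \<Rightarrow> 'a::metric_space) \<Rightarrow> (nat \<Rightarrow> 'b::metric_space) \<Rightarrow> bool" where
  "of_class \<rho> N x y \<longleftrightarrow> disc_seminorm \<rho> N x y < \<infinity>"

text \<open>As the target need not be a vector space, the sum of the \<open>f (xh i)\<close> times indicators of
  the cells \<open>P i\<close> is read as the function with value \<open>f (xh i)\<close> on \<open>P i\<close>.  The index is
  unique, and the value meaningful, when the cells are disjoint and one of them contains \<open>u\<close>.\<close>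

definition pc_interpolant ::
  "nat \<Rightarrow> (nat \<Rightarrow> 'a) \<Rightarrow> (nat \<Rightarrow> 'a set) \<Rightarrow> ('a \<Rightarrow> 'b) \<Rightarrow> 'a \<Rightarrow> 'b" where
  "pc_interpolant M xh P f u = f (xh (THE i. i \<in> {1..M} \<and> u \<in> P i))"

end

theory Submission
  imports Defs
begin

text \<open>A site and the representative of its cell are at most the diameter of the cell apart,
  hence at most \<open>h\<close>. The interpolation error at the site is therefore the distance
  between the values at two sites within \<open>h\<close> of each other, and the modulus at
  \<open>h\<close> bounds it by its very definition. For a general majorant,
  \<open>dist_le_disc_seminorm\<close> works at the actual distance \<open>d\<close> of the two
  sites: if \<open>\<rho> d\<close> is positive and finite, the modulus at \<open>d\<close> is
  \<open>\<rho> d\<close> times a quotient occurring in the seminorm, and monotonicity replaces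
  \<open>\<rho> d\<close> by \<open>\<rho> h\<close>.\<close>

lemma dist_le_disc_modulus:
  assumes "i \<in> {1..N}" "j \<in> {1..N}" "ennreal (dist (x i) (x j)) \<le> t"
  shows "ennreal (dist (y i) (y j)) \<le> disc_modulus N x y t"
  unfolding disc_modulus_def
proof (rule Max_ge)
  have "{ennreal (dist (y i) (y j)) |i j.
            i \<in> {1..N} \<and> j \<in> {1..N} \<and> ennreal (dist (x i) (x j)) \<le> t}
      \<subseteq> (\<lambda>(i, j). ennreal (dist (y i) (y j))) ` ({1..N} \<times> {1..N})"
    by auto
  then show "finite {ennreal (dist (y i) (y j)) |i j.
            i \<in> {1..N} \<and> j \<in> {1..N} \<and> ennreal (dist (x i) (x j)) \<le> t}"
    by (rule finite_subset) simp
qed (use assms in blast)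

text \<open>Multiplying by \<open>\<rho> d\<close> undoes the factor
  \<open>inverse (\<rho> d)\<close> only away from \<open>0\<close> and \<open>\<infinity>\<close>.
  The lower bound by \<open>C\<close> times the modulus excludes \<open>0\<close> when the values
  differ; \<open>indet\<close> settles the case \<open>\<infinity>\<close>.\<close>

lemma dist_le_disc_seminorm:
  fixes \<rho> :: "ennreal \<Rightarrow> ennreal"
  assumes ij: "i \<in> {1..N}" "j \<in> {1..N}"
    and le: "ennreal (dist (x i) (x j)) \<le> t"
    and mono: "mono \<rho>"
    and C: "C > 0" "\<And>t. ennreal C * disc_modulus N x y t \<le> \<rho> t"
    and indet: "\<not> (\<rho> t = \<infinity> \<and> disc_seminorm \<rho> N x y = 0)"
  shows "ennreal (dist (y i) (y j)) \<le> \<rho> t * disc_seminorm \<rho> N x y"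
proof (cases "y i = y j")
  case False
  define d where "d = ennreal (dist (x i) (x j))"
  define w where "w = disc_modulus N x y d"
  have dw: "ennreal (dist (y i) (y j)) \<le> w"
    unfolding w_def by (rule dist_le_disc_modulus[OF ij]) (simp add: d_def)
  \<comment> \<open>Distinct values make the modulus at \<open>d\<close> positive, and the majorant
    inherits this.\<close>
  have "ennreal C * w > 0"
    using False dw C(1) by (auto simp: ennreal_zero_less_mult_iff intro: less_le_trans[OF _ dw])
  then have pos: "\<rho> d > 0"
    using C(2)[of d] by (auto simp: w_def intro: less_le_trans)
  have \<rho>le: "\<rho> d \<le> \<rho> t"
    using mono le by (simp add: d_def monoD)
  \<comment> \<open>Distinct values force \<open>i \<noteq> j\<close>, so this pair takes part in
    the supremum.\<close>
  have S: "inverse (\<rho> d) * w \<le> disc_seminorm \<rho> N x y"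
    unfolding disc_seminorm_def w_def d_def
    by (rule SUP_upper2[of "(i, j)"]) (use ij False in auto)
  show ?thesis
  proof (cases "\<rho> d = \<infinity>")
    case True
    then have "\<rho> t = \<infinity>"
      using \<rho>le by (simp add: top_unique)
    \<comment> \<open>By \<open>indet\<close> the seminorm is nonzero, so the right-hand side is
      \<open>\<infinity>\<close>.\<close>
    then show ?thesis
      using indet by (simp add: ennreal_top_mult)
  next
    case False
    then have "\<rho> d * inverse (\<rho> d) = 1"
      using pos ennreal_divide_self[of "\<rho> d"]
      by (simp add: less_top divide_ennreal_def)
    then have "w = \<rho> d * (inverse (\<rho> d) * w)"
      by (metis mult.assoc mult_1)
    also have "\<dots> \<le> \<rho> t * disc_seminorm \<rho> N x y"
      by (intro mult_mono \<rho>le S) auto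
    finally show ?thesis
      using dw by simp
  qed
qed simp

lemma pc_interpolant_eq:
  assumes "disjoint_family_on P {1..M}" "k \<in> {1..M}" "u \<in> P k"
  shows "pc_interpolant M xh P f u = f (xh k)"
proof -
  have "(THE i. i \<in> {1..M} \<and> u \<in> P i) = k"
    using assms unfolding disjoint_family_on_def by (intro the_equality) blast+
  then show ?thesis
    by (simp add: pc_interpolant_def)
qed

theorem corollary6p4:
  fixes X :: "'a::metric_space set"
    and x :: "nat \<Rightarrow> 'a" and y :: "nat \<Rightarrow> 'b::metric_space" and f :: "'a \<Rightarrow> 'b"
    and P :: "nat \<Rightarrow> 'a set" and xh :: "nat \<Rightarrow> 'a"
    and N M :: nat and h :: real
  assumes "compact X"
    and "N \<ge> 1"
    and "x ` {1..N} \<subseteq> X"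
    and "\<And>i. i \<in> {1..N} \<Longrightarrow> f (x i) = y i"
    and "x ` {1..N} = (\<Union>i\<in>{1..M}. P i)"
    and "disjoint_family_on P {1..M}"
    and "\<And>i. i \<in> {1..M} \<Longrightarrow> xh i \<in> P i"
    and "h > 0"
    and "\<And>i. i \<in> {1..M} \<Longrightarrow> diameter (P i) \<le> h"
  shows "(\<forall>\<rho> :: ennreal \<Rightarrow> ennreal.
            mono \<rho> \<longrightarrow>
            (\<exists>C::real. C > 0 \<and> (\<forall>t. \<rho> t \<ge> ennreal C * disc_modulus N x y t)) \<longrightarrow>
            of_class \<rho> N x y \<longrightarrow>
            \<not> (\<rho> (ennreal h) = \<infinity> \<and> disc_seminorm \<rho> N x y = 0) \<longrightarrow>
            (SUP u \<in> x ` {1..N}. ennreal (dist (f u) (pc_interpolant M xh P f u)))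
              \<le> \<rho> (ennreal h) * disc_seminorm \<rho> N x y)
       \<and> (SUP u \<in> x ` {1..N}. ennreal (dist (f u) (pc_interpolant M xh P f u)))
              \<le> disc_modulus N x y (ennreal h)"
proof -
  have sites: "\<exists>i\<in>{1..N}. \<exists>j\<in>{1..N}. ennreal (dist (x i) (x j)) \<le> ennreal h \<and>
      dist (f u) (pc_interpolant M xh P f u) = dist (y i) (y j)"
    if u: "u \<in> x ` {1..N}" for u
  proof -
    obtain k where k: "k \<in> {1..M}" "u \<in> P k"
      using u unfolding assms(5) by blast
    have "P k \<subseteq> x ` {1..N}"
      unfolding assms(5) using k(1) by blast
    \<comment> \<open>A cell is a set of sites, hence finite; boundedness is what lets
      \<open>diameter\<close> dominate the distances within it.\<close>
    then have "xh k \<in> x ` {1..N}" "bounded (P k)"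
      using assms(7)[OF k(1)] by (auto intro: finite_imp_bounded finite_subset)
    from this(1) obtain j where j: "j \<in> {1..N}" "xh k = x j"
      by blast
    obtain i where i: "i \<in> {1..N}" "u = x i"
      using u by blast
    have "dist u (xh k) \<le> h"
      using diameter_bounded_bound[OF \<open>bounded (P k)\<close> k(2) assms(7)[OF k(1)]] assms(9)[OF k(1)] by simp
    then have "ennreal (dist (x i) (x j)) \<le> ennreal h"
      unfolding i j by (rule ennreal_leI)
    moreover have "dist (f u) (pc_interpolant M xh P f u) = dist (y i) (y j)"
      unfolding pc_interpolant_eq[OF assms(6) k] j(2)
      unfolding i(2) assms(4)[OF i(1)] assms(4)[OF j(1)] ..
    ultimately show ?thesis
      using i(1) j(1) by blast
  qed
  \<comment> \<open>With \<open>B\<close> left open, both estimates reduce to pairs of sites within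
    \<open>h\<close>.\<close>
  have sup_le: "(SUP u \<in> x ` {1..N}. ennreal (dist (f u) (pc_interpolant M xh P f u))) \<le> B"
    if B: "\<And>i j. i \<in> {1..N} \<Longrightarrow> j \<in> {1..N} \<Longrightarrow>
      ennreal (dist (x i) (x j)) \<le> ennreal h \<Longrightarrow> ennreal (dist (y i) (y j)) \<le> B" for B
  proof (rule SUP_least)
    fix u assume "u \<in> x ` {1..N}"
    from sites[OF this] obtain i j
      where ij: "i \<in> {1..N}" "j \<in> {1..N}" "ennreal (dist (x i) (x j)) \<le> ennreal h"
        and eq: "dist (f u) (pc_interpolant M xh P f u) = dist (y i) (y j)"
      by blast
    show "ennreal (dist (f u) (pc_interpolant M xh P f u)) \<le> B"
      unfolding eq by (rule B[OF ij])
  qed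
  show ?thesis
  proof (intro conjI allI impI)
    fix \<rho> :: "ennreal \<Rightarrow> ennreal"
    assume "mono \<rho>"
      and "\<exists>C::real. C > 0 \<and> (\<forall>t. \<rho> t \<ge> ennreal C * disc_modulus N x y t)"
      and "\<not> (\<rho> (ennreal h) = \<infinity> \<and> disc_seminorm \<rho> N x y = 0)"
    then show "(SUP u \<in> x ` {1..N}. ennreal (dist (f u) (pc_interpolant M xh P f u)))
        \<le> \<rho> (ennreal h) * disc_seminorm \<rho> N x y"
      by (elim exE conjE) (rule sup_le, rule dist_le_disc_seminorm, assumption+, erule spec, assumption)
  \<comment> \<open>The second bound comes straight from the modulus, without specialising
    \<open>\<rho>\<close>.\<close>
  qed (rule sup_le, rule dist_le_disc_modulus)
qed

end
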